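(* Let $a_{0} \ge 3$ and $k \ge 4$ be fixed integers. Let $A$ be the set of integers with least element $a_0$ defined by the following greedy algorithm: $a_0 \in A$, and for any integer $n > a_{0}$, $n \in A$ if and only if there are no $a, b \in A$ with $a, b < n$ (where $a = b$ is allowed) such that $n = kb - a$. Then \[ A = \bigcup_{n=0}^{\infty}[a_{n}, b_{n}], \] where $b_{0} = \left\lfloor \frac{ka_{0}}{2} \right\rfloor$, and $a_{l} = kb_{l-1} - a_{0} + 1$ and $b_{l} = \left\lfloor \frac{ka_{l}}{2} \right\rfloor$ for all integers $l\ge 1$.
   Context: For integers $x \le y$, $[x,y]$ denotes the set of all integers $m$ with $x \le m \le y$. $\lfloor x\rfloor$ denotes the greatest integer not exceeding $x$. *)

theory Defs
  imports Complex_Main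
begin

text \<open>
  The branch \<open>n \<le> a0\<close> makes \<open>a0\<close> the least element and grounds the recursion. Afterwards
  membership of \<open>n\<close> is decided by the members below \<open>n\<close>; \<open>a = b\<close> is allowed.
  The three lemmas below characterise \<open>greedy_set k a0\<close> uniquely.
\<close>

function greedy_mem :: "int \<Rightarrow> int \<Rightarrow> int \<Rightarrow> bool" where
  "greedy_mem k a0 n \<longleftrightarrow>
     (if n \<le> a0 then n = a0
      else \<not> (\<exists>a\<in>{..<n}. \<exists>b\<in>{..<n}. greedy_mem k a0 a \<and> greedy_mem k a0 b \<and> n = k * b - a))"
  by pat_completeness auto
termination
  by (relation "Wellfounded.measure (\<lambda>(k, a0, n). nat (n - a0))") auto

declare greedy_mem.simps [simp del]

definition greedy_set :: "int \<Rightarrow> int \<Rightarrow> int set" where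
  "greedy_set k a0 = {n. greedy_mem k a0 n}"

lemma greedy_set_first: "a0 \<in> greedy_set k a0"
  unfolding greedy_set_def mem_Collect_eq by (subst greedy_mem.simps) (simp only: order_refl if_True)

lemma greedy_set_least: "n \<in> greedy_set k a0 \<Longrightarrow> a0 \<le> n"
  unfolding greedy_set_def mem_Collect_eq
  by (subst (asm) greedy_mem.simps) (simp split: if_split_asm)

lemma greedy_set_iff:
  assumes "n > a0"
  shows "n \<in> greedy_set k a0 \<longleftrightarrow>
    \<not> (\<exists>a\<in>greedy_set k a0. \<exists>b\<in>greedy_set k a0. a < n \<and> b < n \<and> n = k * b - a)"
proof -
  from assms have "\<not> n \<le> a0" by simp
  then have "greedy_mem k a0 n \<longleftrightarrow>
      \<not> (\<exists>a\<in>{..<n}. \<exists>b\<in>{..<n}. greedy_mem k a0 a \<and> greedy_mem k a0 b \<and> n = k * b - a)"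
    by (subst greedy_mem.simps) (simp only: if_False)
  then show ?thesis
    unfolding greedy_set_def by blast
qed

fun lower_end :: "int \<Rightarrow> int \<Rightarrow> nat \<Rightarrow> int"
  and upper_end :: "int \<Rightarrow> int \<Rightarrow> nat \<Rightarrow> int" where
  "lower_end k a0 0 = a0"
| "lower_end k a0 (Suc l) = k * upper_end k a0 l - a0 + 1"
| "upper_end k a0 l = \<lfloor>real_of_int (k * lower_end k a0 l) / 2\<rfloor>"

end

theory Submission
  imports Defs
begin

text \<open>
  Write \<open>a\<^sub>l\<close>, \<open>b\<^sub>l\<close> for the proposed endpoints and \<open>U\<close> for the union of the intervals
  \<open>[a\<^sub>l, b\<^sub>l]\<close>. The greedy rule determines its set uniquely by strong induction, so it suffices
  that \<open>U\<close> obeys the rule (\<open>greedy_set_eqI\<close>): an integer \<open>n > a\<^sub>0\<close> lies in \<open>U\<close> iff it is not of the form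
  \<open>k * b - a\<close> with \<open>a, b \<in> U\<close> below \<open>n\<close>.

  No \<open>n \<in> [a\<^sub>l, b\<^sub>l]\<close> is of this form (\<open>interval_not_representable\<close>): if \<open>b \<ge> a\<^sub>l\<close>, then
  \<open>n + a < 2 * b\<^sub>l \<le> k * a\<^sub>l \<le> k * b\<close>, and if \<open>b \<le> b\<^bsub>l-1\<^esub>\<close>, then
  \<open>k * b - a \<le> k * b\<^bsub>l-1\<^esub> - a\<^sub>0 < a\<^sub>l\<close>.

  Conversely, let \<open>n\<close> lie in the gap \<open>b\<^sub>l < n < a\<^bsub>l+1\<^esub>\<close> and put \<open>m = k * b\<^sub>l - n \<ge> a\<^sub>0\<close>. For every
  \<open>i\<close>, \<open>n = k * (b\<^sub>l - i) - (m - k * i)\<close>. Let \<open>[a\<^sub>j, b\<^sub>j]\<close>, \<open>j \<le> l\<close>, be the last of the first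
  \<open>l + 1\<close> intervals that starts at or before \<open>m\<close>. Every interval has at least \<open>k\<close> elements, so
  some \<open>i \<ge> 0\<close> moves \<open>m - k * i\<close> into \<open>[a\<^sub>j, b\<^sub>j]\<close>, and a size estimate lets \<open>i\<close> be chosen with
  \<open>i \<le> b\<^sub>l - a\<^sub>l\<close>, so that \<open>b\<^sub>l - i \<in> [a\<^sub>l, b\<^sub>l]\<close> (\<open>gap_representable\<close>).
\<close>

section \<open>Uniqueness of the greedy set\<close>

text \<open>The greedy rule has only one solution with least element \<open>a\<^sub>0\<close>.\<close>

lemma greedy_set_eqI:
  assumes first: "a0 \<in> U"
    and least: "\<And>n. n \<in> U \<Longrightarrow> a0 \<le> n"
    and rule: "\<And>n. n > a0 \<Longrightarrow>
      n \<in> U \<longleftrightarrow> \<not> (\<exists>a\<in>U. \<exists>b\<in>U. a < n \<and> b < n \<and> n = k * b - a)"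
  shows "greedy_set k a0 = U"
proof -
  have agree: "n \<in> greedy_set k a0 \<longleftrightarrow> n \<in> U" if "a0 \<le> n" for n
    using that
  proof (induction "nat (n - a0)" arbitrary: n rule: less_induct)
    case less
    show ?case
    proof (cases "n = a0")
      case True
      then show ?thesis using greedy_set_first first by simp
    next
      case False
      with less.prems have n: "n > a0" by simp
      have below: "x \<in> greedy_set k a0 \<longleftrightarrow> x \<in> U" if "x < n" for x
      proof (cases "a0 \<le> x")
        case True
        then show ?thesis using less.hyps[of x] that by simp
      next
        case False
        then show ?thesis using greedy_set_least least by blast
      qed
      show ?thesis
        unfolding greedy_set_iff[OF n] rule[OF n]
        using below by blast
    qed
  qed
  show ?thesis
    using agree greedy_set_least least by blast
qed

section \<open>The endpoints of the intervals\<close>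

lemma upper_end_bounds:
  "2 * upper_end k a0 l \<le> k * lower_end k a0 l"
  "k * lower_end k a0 l \<le> 2 * upper_end k a0 l + 1"
proof -
  have "upper_end k a0 l = k * lower_end k a0 l div 2"
    using floor_divide_of_int_eq[of "k * lower_end k a0 l" 2, where ?'a = real] by simp
  then show "2 * upper_end k a0 l \<le> k * lower_end k a0 l"
    "k * lower_end k a0 l \<le> 2 * upper_end k a0 l + 1"
    by linarith+
qed

text \<open>The two bounds determine \<open>b\<^sub>l\<close>, so its defining equation is no longer needed.\<close>

declare upper_end.simps [simp del]

lemma mem_some_interval:
  assumes "lower_end k a0 j \<le> x" "x \<le> upper_end k a0 j"
  shows "x \<in> (\<Union>n. {lower_end k a0 n .. upper_end k a0 n})"
  using assms by auto

text \<open>Steps of size \<open>k\<close> cannot jump over an interval with at least \<open>k\<close> elements.\<close>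

lemma shift_into_interval:
  fixes a b c k m :: int
  assumes "k > 0" "k \<le> b - a + 1" "a \<le> m" "m \<le> b + k * c" "0 \<le> c"
  obtains i where "0 \<le> i" "i \<le> c" "a \<le> m - k * i" "m - k * i \<le> b"
proof (cases "(m - a) div k \<le> c")
  case True
  have "0 \<le> (m - a) mod k" "(m - a) mod k < k" "0 \<le> (m - a) div k"
    using assms by (simp_all add: pos_imp_zdiv_nonneg_iff)
  moreover have "(m - a) mod k = m - a - k * ((m - a) div k)"
    by (simp add: minus_mult_div_eq_mod)
  ultimately show ?thesis
    using that[of "(m - a) div k"] True assms by linarith
next
  case False
  then have "k * c \<le> k * ((m - a) div k)"
    using assms by (intro mult_left_mono) auto
  also have "\<dots> \<le> m - a"
    using assms pos_mod_sign[of k "m - a"] minus_mult_div_eq_mod[of "m - a" k] by linarith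
  finally show ?thesis
    using that[of c] assms by linarith
qed

context
  fixes a0 k :: int
  assumes a0: "a0 \<ge> 3" and k: "k \<ge> 4"
begin

lemma upper_end_ge_double:
  assumes "lower_end k a0 l \<ge> 0"
  shows "2 * lower_end k a0 l \<le> upper_end k a0 l"
proof -
  have "4 * lower_end k a0 l \<le> k * lower_end k a0 l"
    using assms k by (intro mult_right_mono) auto
  with upper_end_bounds(2)[of k a0 l] show ?thesis by linarith
qed

lemma upper_end_less_next:
  assumes "upper_end k a0 l \<ge> a0"
  shows "upper_end k a0 l < lower_end k a0 (Suc l)"
proof -
  have "4 * upper_end k a0 l \<le> k * upper_end k a0 l"
    using assms a0 k by (intro mult_right_mono) auto
  with assms a0 show ?thesis
    unfolding lower_end.simps by linarith
qed

lemma lower_end_ge: "lower_end k a0 l \<ge> a0"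
proof (induction l)
  case 0
  show ?case by simp
next
  case (Suc l)
  with upper_end_ge_double[of l] upper_end_less_next[of l] a0 show ?case by linarith
qed

lemma ends_order:
  "2 * lower_end k a0 l \<le> upper_end k a0 l"
  "upper_end k a0 l < lower_end k a0 (Suc l)"
  "lower_end k a0 l < lower_end k a0 (Suc l)"
proof -
  show *: "2 * lower_end k a0 l \<le> upper_end k a0 l"
    using lower_end_ge[of l] a0 by (intro upper_end_ge_double) auto
  show **: "upper_end k a0 l < lower_end k a0 (Suc l)"
    using * lower_end_ge[of l] a0 by (intro upper_end_less_next) auto
  show "lower_end k a0 l < lower_end k a0 (Suc l)"
    using * ** lower_end_ge[of l] a0 by linarith
qed

lemma lower_end_mono: "i \<le> j \<Longrightarrow> lower_end k a0 i \<le> lower_end k a0 j"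
  by (rule lift_Suc_mono_le) (use ends_order(3) in \<open>auto intro: less_imp_le\<close>)

lemma upper_end_mono: "i \<le> j \<Longrightarrow> upper_end k a0 i \<le> upper_end k a0 j"
proof (rule lift_Suc_mono_le)
  fix n
  show "upper_end k a0 n \<le> upper_end k a0 (Suc n)"
    using ends_order(2)[of n] ends_order(1)[of "Suc n"] lower_end_ge[of "Suc n"] a0 by linarith
qed

lemma lower_end_unbounded: "lower_end k a0 l \<ge> int l"
proof (induction l)
  case 0
  show ?case using a0 by simp
next
  case (Suc l)
  with ends_order(3)[of l] show ?case by linarith
qed

text \<open>
  Every interval contains a complete residue system modulo \<open>k\<close>. The estimate reduces to
  \<open>3 * (k - 2) \<ge> 2 * (k - 1)\<close>, and for \<open>a\<^sub>0 = 3\<close>, \<open>k = 4\<close> it is sharp: \<open>[3, 6]\<close> has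
  exactly four elements.
\<close>

lemma interval_length: "k \<le> upper_end k a0 l - lower_end k a0 l + 1"
proof -
  have "(k - 2) * 3 \<le> (k - 2) * lower_end k a0 l"
    using lower_end_ge[of l] a0 k by (intro mult_left_mono) auto
  with upper_end_bounds(2)[of k a0 l] k show ?thesis
    by (simp only: left_diff_distrib)
qed

lemma last_start_before:
  assumes "a0 \<le> n"
  obtains l where "lower_end k a0 l \<le> n" "n < lower_end k a0 (Suc l)"
proof -
  define L where "L = (LEAST l. n < lower_end k a0 l)"
  have ex: "n < lower_end k a0 (nat n + 1)"
    using lower_end_unbounded[of "nat n + 1"] by linarith
  have L: "n < lower_end k a0 L"
    unfolding L_def using ex by (rule LeastI)
  with assms obtain l where l: "L = Suc l"
    by (cases L) auto
  have "\<not> n < lower_end k a0 l"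
    using not_less_Least[of l "\<lambda>l. n < lower_end k a0 l"] l unfolding L_def by simp
  with that[of l] L l show ?thesis by simp
qed

section \<open>The union of the intervals obeys the greedy rule\<close>

lemma interval_not_representable:
  assumes n: "lower_end k a0 l \<le> n" "n \<le> upper_end k a0 l"
    and a: "a \<in> (\<Union>n. {lower_end k a0 n .. upper_end k a0 n})" "a < n"
    and b: "b \<in> (\<Union>n. {lower_end k a0 n .. upper_end k a0 n})" "b < n"
  shows "n \<noteq> k * b - a"
proof (cases "lower_end k a0 l \<le> b")
  case True
  then have "k * lower_end k a0 l \<le> k * b"
    using k by (intro mult_left_mono) auto
  with upper_end_bounds(1)[of k a0 l] n a(2) show ?thesis by linarith
next
  case False
  from b(1) obtain j where j: "lower_end k a0 j \<le> b" "b \<le> upper_end k a0 j"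
    by auto
  have "j < l"
    using lower_end_mono[of l j] j False by linarith
  then obtain l' where l': "l = Suc l'" "j \<le> l'"
    by (cases l) auto
  have "k * b \<le> k * upper_end k a0 l'"
    using j upper_end_mono[OF l'(2)] k by (intro mult_left_mono) auto
  moreover have "a0 \<le> a"
    using a(1) lower_end_ge by (auto intro: order_trans)
  ultimately show ?thesis
    using n(1) l'(1) by simp
qed

lemma gap_representable:
  assumes n: "upper_end k a0 l < n" "n < lower_end k a0 (Suc l)"
  obtains a b where
    "a \<in> (\<Union>n. {lower_end k a0 n .. upper_end k a0 n})" "a < n"
    "b \<in> (\<Union>n. {lower_end k a0 n .. upper_end k a0 n})" "b < n"
    "n = k * b - a"
proof -
  let ?m = "k * upper_end k a0 l - n"
  let ?c = "upper_end k a0 l - lower_end k a0 l"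
  have m: "a0 \<le> ?m" using n(2) by simp
  have c: "0 \<le> ?c" using ends_order(1)[of l] lower_end_ge[of l] a0 by linarith
  have "\<exists>j\<le>l. lower_end k a0 j \<le> ?m \<and> ?m \<le> upper_end k a0 j + k * ?c"
  proof (cases "lower_end k a0 l \<le> ?m")
    case True
    have "k * ?c = k * upper_end k a0 l - k * lower_end k a0 l"
      by (simp add: right_diff_distrib)
    with True upper_end_bounds(2)[of k a0 l] n(1) show ?thesis
      by (intro exI[of _ l]) linarith
  next
    case False
    from m obtain j where j: "lower_end k a0 j \<le> ?m" "?m < lower_end k a0 (Suc j)"
      by (rule last_start_before)
    have "j < l"
      using lower_end_mono[of l j] j(1) False by linarith
    then have "lower_end k a0 (Suc j) \<le> lower_end k a0 l"
      by (intro lower_end_mono) simp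
    \<comment> \<open>The last interval is so long that \<open>b\<^sub>l - a\<^sub>l \<ge> a\<^sub>l > b\<^sub>j\<close>.\<close>
    with ends_order(2)[of j] ends_order(1)[of l] have "upper_end k a0 j \<le> ?c"
      by linarith
    then have "k * upper_end k a0 j \<le> k * ?c"
      using k by (intro mult_left_mono) auto
    moreover have "?m \<le> k * upper_end k a0 j - a0"
      using j(2) by simp
    moreover have "0 \<le> upper_end k a0 j"
      using ends_order(1)[of j] lower_end_ge[of j] a0 by linarith
    ultimately have "?m \<le> upper_end k a0 j + k * ?c"
      using a0 by linarith
    with j \<open>j < l\<close> show ?thesis
      by (intro exI[of _ j]) auto
  qed
  then obtain j where j: "j \<le> l" "lower_end k a0 j \<le> ?m" "?m \<le> upper_end k a0 j + k * ?c"
    by blast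
  obtain i where i: "0 \<le> i" "i \<le> ?c"
      "lower_end k a0 j \<le> ?m - k * i" "?m - k * i \<le> upper_end k a0 j"
    by (rule shift_into_interval[OF _ interval_length j(2,3) c]) (use k in auto)
  show ?thesis
  proof (rule that)
    show "?m - k * i \<in> (\<Union>n. {lower_end k a0 n .. upper_end k a0 n})"
      using i(3,4) by (rule mem_some_interval)
    show "?m - k * i < n"
      using i(4) upper_end_mono[OF j(1)] n(1) by linarith
    show "upper_end k a0 l - i \<in> (\<Union>n. {lower_end k a0 n .. upper_end k a0 n})"
      using i(1,2) by (intro mem_some_interval[of _ _ l]) linarith+
    show "upper_end k a0 l - i < n"
      using i(1) n(1) by linarith
    show "n = k * (upper_end k a0 l - i) - (?m - k * i)"
      by (simp add: right_diff_distrib)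
  qed
qed

lemma union_intervals_iff:
  assumes "n > a0"
  defines "U \<equiv> (\<Union>n. {lower_end k a0 n .. upper_end k a0 n})"
  shows "n \<in> U \<longleftrightarrow> \<not> (\<exists>a\<in>U. \<exists>b\<in>U. a < n \<and> b < n \<and> n = k * b - a)"
proof
  assume "n \<in> U"
  then obtain l where "lower_end k a0 l \<le> n" "n \<le> upper_end k a0 l"
    unfolding U_def UN_iff atLeastAtMost_iff by blast
  then show "\<not> (\<exists>a\<in>U. \<exists>b\<in>U. a < n \<and> b < n \<and> n = k * b - a)"
    unfolding U_def using interval_not_representable by blast
next
  assume no_rep: "\<not> (\<exists>a\<in>U. \<exists>b\<in>U. a < n \<and> b < n \<and> n = k * b - a)"
  from assms(1) have "a0 \<le> n" by simp
  then obtain l where l: "lower_end k a0 l \<le> n" "n < lower_end k a0 (Suc l)"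
    by (rule last_start_before)
  have "n \<le> upper_end k a0 l"
  proof (rule ccontr)
    assume "\<not> n \<le> upper_end k a0 l"
    then have "upper_end k a0 l < n" by simp
    from this l(2) obtain a b where "a \<in> U" "a < n" "b \<in> U" "b < n" "n = k * b - a"
      unfolding U_def by (rule gap_representable)
    with no_rep show False by blast
  qed
  with l(1) show "n \<in> U"
    unfolding U_def by (rule mem_some_interval)
qed

end

theorem theorem4:
  fixes a0 k :: int
  assumes "a0 \<ge> 3" and "k \<ge> 4"
  shows "greedy_set k a0 = (\<Union>n::nat. {lower_end k a0 n .. upper_end k a0 n})"
proof (rule greedy_set_eqI)
  show "a0 \<in> (\<Union>n. {lower_end k a0 n .. upper_end k a0 n})"
    using ends_order(1)[OF assms, of 0] assms by (intro mem_some_interval[of _ _ 0]) auto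
  show "a0 \<le> n" if "n \<in> (\<Union>n. {lower_end k a0 n .. upper_end k a0 n})" for n
    using that lower_end_ge[OF assms] by (auto intro: order_trans)
qed (rule union_intervals_iff[OF assms])

end
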